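(* Let $\Omega$ be a nonempty set and let $(X,\leq_X)$ and $(\{\lfloor\,\rfloor^R_\omega,\lfloor\,\rfloor^S_\omega\mid\omega\in\Omega\},\leq_\Omega)$ be two well-ordered sets. Then the order $\leq_{\mathrm{db}}$ defined in the context is a monomial order on $\mathfrak{M}(\Omega_R\sqcup\Omega_S,X)$; that is, it is a well order and $u<_{\mathrm{db}}v$ implies $q|_u<_{\mathrm{db}}q|_v$ for all $u,v\in\mathfrak{M}(\Omega_R\sqcup\Omega_S,X)$ and all $q\in\mathfrak{M}^\star(\Omega_R\sqcup\Omega_S,X)$.
   Context: **Bracketed words.** For a set $X$ and nonempty set $\Lambda$, let $M(Y)$ be the free monoid on $Y$ and, for $\omega\in\Lambda$, let $\lfloor Y\rfloor_\omega=\{\lfloor y\rfloor_\omega\mid y\in Y\}$ be a disjoint copy of $Y$ (disjoint for different $\omega$). Set $\mathfrak{M}_0=M(X)$, $\mathfrak{M}_n=M(X\sqcup\bigsqcup_{\omega\in\Lambda}\lfloor\mathfrak{M}_{n-1}\rfloor_\omega)$, with the natural inclusions $\mathfrak{M}_{n-1}\hookrightarrow\mathfrak{M}_n$, and $\mathfrak{M}(\Lambda,X)=\bigcup_n\mathfrak{M}_n$, a monoid with identity $1$ and with operators $w\mapsto\lfloor w\rfloor_\omega$. Elements of $X\sqcup\bigsqcup_\omega\lfloor\mathfrak{M}(\Lambda,X)\rfloor_\omega$ are called prime; if $u=u_1\cdots u_n$ with $u_i$ prime, the breadth is $|u|=n$ (and $|1|=0$). $\mathfrak{M}^\star(\Lambda,X)$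 is the set of words in $\mathfrak{M}(\Lambda,X\sqcup\{\star\})$ in which the new symbol $\star$ occurs exactly once; $q|_u$ is obtained from $q$ by replacing $\star$ by $u$. Here $\Omega_R,\Omega_S$ are two disjoint copies of $\Omega$, $\Lambda=\Omega_R\sqcup\Omega_S$, and $\lfloor\,\rfloor^R_\omega$, $\lfloor\,\rfloor^S_\omega$ ($\omega\in\Omega$) denote the operators indexed by the copies of $\omega$ in $\Omega_R$, $\Omega_S$. **The order $\leq_{\mathrm{db}}$.** Let $\deg(u)$ be the total number of occurrences in $u$ of letters of $X$ and of operators, counted with multiplicity. For $u=u_1\cdots u_m$, $v=v_1\cdots v_n$ with prime factors $u_i,v_j$, $u\leq_{\mathrm{db}}v$ is defined recursively by lexicographic comparison of $(\deg(u),|u|,u_1,\dots,u_m)$ and $(\deg(v),|v|,v_1,\dots,v_n)$, i.e. first by degree, then by breadth, then by prime factors lexicographically; two prime elements of equal degree are compared as follows: elements of $X$ by $\leq_X$; an element of $X$ is smaller than any bracket $\lfloor\tilde v\rfloor$; two brackets $\lfloor\tilde u\rfloor^{\ast_1}_\alpha,\lfloor\tilde v\rfloor^{\ast_2}_\beta$ by lexicographic comparison of $(\lfloor\,\rfloor^{\ast_1}_\alpha,\tilde u)$ and $(\lfloor\,\rfloor^{\ast_2}_\beta,\tilde v)$, using $\leq_\Omega$ and then $\leq_{\mathrm{db}}$. *)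

theory Defs
  imports Main
begin

text \<open>
  A word is the list of its prime factors, so that the monoid operation is \<open>@\<close>, the identity is
  \<open>[]\<close>, and the breadth is \<open>length\<close>. \<open>Bracket \<omega> w\<close> is the prime element obtained by applying the
  operator indexed by \<open>\<omega>\<close> to \<open>w\<close>; letters and brackets with different indices are disjoint by
  construction.
\<close>

datatype ('l, 'x) prime_elem = Letter 'x | Bracket 'l "('l, 'x) prime_elem list"

type_synonym ('l, 'x) bword = "('l, 'x) prime_elem list"

primrec bwords_stage :: "'l set \<Rightarrow> 'x set \<Rightarrow> nat \<Rightarrow> ('l, 'x) bword set" where
  "bwords_stage \<Lambda> X 0 = lists (Letter ` X)"
| "bwords_stage \<Lambda> X (Suc n) =
     lists (Letter ` X \<union> (\<Union>\<omega>\<in>\<Lambda>. Bracket \<omega> ` bwords_stage \<Lambda> X n))"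

definition bwords :: "'l set \<Rightarrow> 'x set \<Rightarrow> ('l, 'x) bword set" where
  "bwords \<Lambda> X = (\<Union>n. bwords_stage \<Lambda> X n)"

primrec occs_prime :: "'x \<Rightarrow> ('l, 'x) prime_elem \<Rightarrow> nat" where
  "occs_prime a (Letter x) = (if x = a then 1 else 0)"
| "occs_prime a (Bracket \<omega> w) = sum_list (map (occs_prime a) w)"

definition occs :: "'x \<Rightarrow> ('l, 'x) bword \<Rightarrow> nat" where
  "occs a w = sum_list (map (occs_prime a) w)"

text \<open>The alphabet extended by the new symbol is rendered by the option type, with \<open>None\<close> for the
  new symbol and \<open>Some x\<close> for the old letter \<open>x\<close>.\<close>

definition star_bwords :: "'l set \<Rightarrow> 'x set \<Rightarrow> ('l, 'x option) bword set" where
  "star_bwords \<Lambda> X = {q \<in> bwords \<Lambda> (insert None (Some ` X)). occs None q = 1}"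

primrec plug_prime :: "('l, 'x) bword \<Rightarrow> ('l, 'x option) prime_elem \<Rightarrow> ('l, 'x) bword" where
  "plug_prime u (Letter a) = (case a of None \<Rightarrow> u | Some x \<Rightarrow> [Letter x])"
| "plug_prime u (Bracket \<omega> w) = [Bracket \<omega> (concat (map (plug_prime u) w))]"

definition plug :: "('l, 'x option) bword \<Rightarrow> ('l, 'x) bword \<Rightarrow> ('l, 'x) bword" where
  "plug q u = concat (map (plug_prime u) q)"

definition monomial_order :: "'l set \<Rightarrow> 'x set \<Rightarrow> ('l, 'x) bword rel \<Rightarrow> bool" where
  "monomial_order \<Lambda> X r \<longleftrightarrow>
     well_order_on (bwords \<Lambda> X) r \<and>
     (\<forall>u\<in>bwords \<Lambda> X. \<forall>v\<in>bwords \<Lambda> X. \<forall>q\<in>star_bwords \<Lambda> X.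
        (u, v) \<in> r - Id \<longrightarrow> (plug q u, plug q v) \<in> r - Id)"

primrec deg_prime :: "('l, 'x) prime_elem \<Rightarrow> nat" where
  "deg_prime (Letter x) = 1"
| "deg_prime (Bracket \<omega> w) = 1 + sum_list (map deg_prime w)"

definition deg :: "('l, 'x) bword \<Rightarrow> nat" where
  "deg w = sum_list (map deg_prime w)"

text \<open>
  The strict part of the order, for (non-strict) orders \<open>rX\<close> on the letters and \<open>rO\<close> on the
  operators. \<open>db_less_lex\<close> is only used for lists of equal length; it compares prime factors as
  words of breadth one, i.e. by degree first. \<open>db_less_tie\<close> is only used for prime elements of
  equal degree.
\<close>

function db_less :: "'x rel \<Rightarrow> 'l rel \<Rightarrow> ('l, 'x) bword \<Rightarrow> ('l, 'x) bword \<Rightarrow> bool"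
  and db_less_lex :: "'x rel \<Rightarrow> 'l rel \<Rightarrow> ('l, 'x) bword \<Rightarrow> ('l, 'x) bword \<Rightarrow> bool"
  and db_less_tie :: "'x rel \<Rightarrow> 'l rel \<Rightarrow> ('l, 'x) prime_elem \<Rightarrow> ('l, 'x) prime_elem \<Rightarrow> bool"
where
  "db_less rX rO u v \<longleftrightarrow>
     deg u < deg v \<or>
     deg u = deg v \<and> (length u < length v \<or> length u = length v \<and> db_less_lex rX rO u v)"
| "db_less_lex rX rO (a # u) (b # v) \<longleftrightarrow>
     deg_prime a < deg_prime b \<or>
     deg_prime a = deg_prime b \<and> db_less_tie rX rO a b \<or>
     a = b \<and> db_less_lex rX rO u v"
| "db_less_lex rX rO [] v \<longleftrightarrow> False"
| "db_less_lex rX rO (a # u) [] \<longleftrightarrow> False"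
| "db_less_tie rX rO (Letter x) (Letter y) \<longleftrightarrow> (x, y) \<in> rX - Id"
| "db_less_tie rX rO (Letter x) (Bracket \<beta> v) \<longleftrightarrow> True"
| "db_less_tie rX rO (Bracket \<alpha> u) (Letter y) \<longleftrightarrow> False"
| "db_less_tie rX rO (Bracket \<alpha> u) (Bracket \<beta> v) \<longleftrightarrow>
     (\<alpha>, \<beta>) \<in> rO - Id \<or> \<alpha> = \<beta> \<and> db_less rX rO u v"
  by pat_completeness auto
termination
  by (relation "measures
      [case_sum (\<lambda>(_, _, u, _). size_list size u)
         (case_sum (\<lambda>(_, _, u, _). size_list size u) (\<lambda>(_, _, a, _). size a)),
       case_sum (\<lambda>_. 1) (case_sum (\<lambda>_. 0) (\<lambda>_. 0))]") auto

definition db_order :: "'l set \<Rightarrow> 'x set \<Rightarrow> 'x rel \<Rightarrow> 'l rel \<Rightarrow> ('l, 'x) bword rel" where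
  "db_order \<Lambda> X rX rO =
     {(u, v). u \<in> bwords \<Lambda> X \<and> v \<in> bwords \<Lambda> X \<and> (u = v \<or> db_less rX rO u v)}"

end

theory Submission
  imports Defs
begin

text \<open>
  Totality, transitivity and compatibility with \<^const>\<open>plug\<close> go by recursion along the definition.
  For well-foundedness, note that the degree is weakly increasing along the order, so that it
  suffices to treat words of one fixed degree \<open>n\<close>, by strong induction on \<open>n\<close>; likewise one may fix
  the breadth. On words of degree \<open>n\<close> and fixed breadth the order is a lexicographic power of the
  order on primes of degree at most \<open>n\<close>. A bracket of degree \<open>k \<le> n\<close> encloses a word of degree
  \<open>k - 1 < n\<close>, so the induction hypothesis applies to its contents.
\<close>

declare db_less.simps [simp del]

section \<open>Bracketed words: stages, concatenation and plugging\<close>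

lemma bwords_stage_Suc_mono: "bwords_stage \<Lambda> X n \<subseteq> bwords_stage \<Lambda> X (Suc n)"
proof (induction n)
  case 0
  show ?case by (auto simp: lists_eq_set)
next
  case (Suc n)
  show ?case
    unfolding bwords_stage.simps(2)[of \<Lambda> X "Suc n"] bwords_stage.simps(2)[of \<Lambda> X n]
    using Suc by (intro lists_mono Un_mono UN_mono image_mono order_refl) simp
qed

lemma bwords_stage_mono: "m \<le> n \<Longrightarrow> bwords_stage \<Lambda> X m \<subseteq> bwords_stage \<Lambda> X n"
  by (rule lift_Suc_mono_le[of "bwords_stage \<Lambda> X"]) (rule bwords_stage_Suc_mono)

lemma Nil_in_bwords_stage: "[] \<in> bwords_stage \<Lambda> X n"
  by (cases n) auto

lemma Nil_in_bwords [simp]: "[] \<in> bwords \<Lambda> X"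
  by (auto simp: bwords_def Nil_in_bwords_stage)

lemma append_in_bwords_stage_iff:
  "u @ v \<in> bwords_stage \<Lambda> X n \<longleftrightarrow> u \<in> bwords_stage \<Lambda> X n \<and> v \<in> bwords_stage \<Lambda> X n"
  by (cases n) auto

lemma append_in_bwords_iff [simp]:
  "u @ v \<in> bwords \<Lambda> X \<longleftrightarrow> u \<in> bwords \<Lambda> X \<and> v \<in> bwords \<Lambda> X"
proof
  assume "u \<in> bwords \<Lambda> X \<and> v \<in> bwords \<Lambda> X"
  then obtain m n where "u \<in> bwords_stage \<Lambda> X m" "v \<in> bwords_stage \<Lambda> X n"
    by (auto simp: bwords_def)
  \<comment> \<open>The stages form a chain, so both factors already lie in the later of their two
    stages.\<close>
  then have "u @ v \<in> bwords_stage \<Lambda> X (max m n)"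
    using bwords_stage_mono[of m "max m n" \<Lambda> X] bwords_stage_mono[of n "max m n" \<Lambda> X]
    by (auto simp: append_in_bwords_stage_iff)
  then show "u @ v \<in> bwords \<Lambda> X" by (auto simp: bwords_def)
qed (auto simp: bwords_def append_in_bwords_stage_iff)

lemma Cons_in_bwords_iff: "a # u \<in> bwords \<Lambda> X \<longleftrightarrow> [a] \<in> bwords \<Lambda> X \<and> u \<in> bwords \<Lambda> X"
  using append_in_bwords_iff[of "[a]" u] by simp

lemma Letter_in_bwords_iff [simp]: "[Letter x] \<in> bwords \<Lambda> X \<longleftrightarrow> x \<in> X"
proof
  assume "[Letter x] \<in> bwords \<Lambda> X"
  then obtain n where "[Letter x] \<in> bwords_stage \<Lambda> X n" by (auto simp: bwords_def)
  then show "x \<in> X" by (cases n) auto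
next
  assume "x \<in> X"
  then have "[Letter x] \<in> bwords_stage \<Lambda> X 0" by simp
  then show "[Letter x] \<in> bwords \<Lambda> X" unfolding bwords_def by blast
qed

lemma Bracket_in_bwords_iff [simp]:
  "[Bracket \<omega> w] \<in> bwords \<Lambda> X \<longleftrightarrow> \<omega> \<in> \<Lambda> \<and> w \<in> bwords \<Lambda> X"
proof
  assume "[Bracket \<omega> w] \<in> bwords \<Lambda> X"
  then obtain n where "[Bracket \<omega> w] \<in> bwords_stage \<Lambda> X n" by (auto simp: bwords_def)
  then show "\<omega> \<in> \<Lambda> \<and> w \<in> bwords \<Lambda> X" by (cases n) (auto simp: bwords_def)
next
  assume "\<omega> \<in> \<Lambda> \<and> w \<in> bwords \<Lambda> X"
  then obtain n where "\<omega> \<in> \<Lambda>" "w \<in> bwords_stage \<Lambda> X n" by (auto simp: bwords_def)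
  then have "[Bracket \<omega> w] \<in> bwords_stage \<Lambda> X (Suc n)" by auto
  then show "[Bracket \<omega> w] \<in> bwords \<Lambda> X" unfolding bwords_def by blast
qed

lemma concat_in_bwords: "(\<And>w. w \<in> set ws \<Longrightarrow> w \<in> bwords \<Lambda> X) \<Longrightarrow> concat ws \<in> bwords \<Lambda> X"
  by (induction ws) auto

lemma set_bwords: "w \<in> bwords \<Lambda> X \<Longrightarrow> a \<in> set w \<Longrightarrow> [a] \<in> bwords \<Lambda> X"
  by (auto dest!: split_list) (metis Cons_in_bwords_iff append_in_bwords_iff)

lemma plug_prime_in_bwords:
  assumes "u \<in> bwords \<Lambda> X"
  shows "[p] \<in> bwords \<Lambda> (insert None (Some ` X)) \<Longrightarrow> plug_prime u p \<in> bwords \<Lambda> X"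
proof (induction p)
  case (Letter a)
  then show ?case using assms by (auto split: option.splits)
next
  case (Bracket \<omega> w)
  then have "plug_prime u p \<in> bwords \<Lambda> X" if "p \<in> set w" for p
    using that by (auto dest: set_bwords)
  then show ?case using Bracket.prems by (auto intro!: concat_in_bwords)
qed

lemma plug_in_bwords:
  "u \<in> bwords \<Lambda> X \<Longrightarrow> q \<in> bwords \<Lambda> (insert None (Some ` X)) \<Longrightarrow> plug q u \<in> bwords \<Lambda> X"
  by (auto simp: plug_def intro!: concat_in_bwords plug_prime_in_bwords dest: set_bwords)

lemma deg_append [simp]: "deg (u @ v) = deg u + deg v"
  by (simp add: deg_def)

section \<open>Totality and transitivity of the comparison\<close>

lemma db_less_total:
  assumes "total_on X rX" "total_on \<Lambda> rO"
  shows "u \<in> bwords \<Lambda> X \<Longrightarrow> v \<in> bwords \<Lambda> X \<Longrightarrow> u = v \<or> db_less rX rO u v \<or> db_less rX rO v u"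
    and "u' \<in> bwords \<Lambda> X \<Longrightarrow> v' \<in> bwords \<Lambda> X \<Longrightarrow> length u' = length v' \<Longrightarrow>
      u' = v' \<or> db_less_lex rX rO u' v' \<or> db_less_lex rX rO v' u'"
    and "[a] \<in> bwords \<Lambda> X \<Longrightarrow> [b] \<in> bwords \<Lambda> X \<Longrightarrow>
      a = b \<or> db_less_tie rX rO a b \<or> db_less_tie rX rO b a"
  \<comment> \<open>The base orders are arguments of the mutual recursion and vary in its induction
    rule, so the assumptions on them have to go through the induction.\<close>
  using assms
proof (induction rX rO u v and rX rO u' v' and rX rO a b
    rule: db_less_db_less_lex_db_less_tie.induct)
  case (1 rX rO u v)
  then show ?case by (auto simp: db_less.simps)
next
  case (2 rX rO a u b v)
  then show ?case
    using Cons_in_bwords_iff[of a u] Cons_in_bwords_iff[of b v] by auto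
qed (auto simp: total_on_def)

lemma db_less_trans:
  assumes "trans (rX - Id)" "trans (rO - Id)"
  shows "db_less rX rO u v \<Longrightarrow> db_less rX rO v w \<Longrightarrow> db_less rX rO u w"
    and "db_less_lex rX rO u' v' \<Longrightarrow> db_less_lex rX rO v' w' \<Longrightarrow> db_less_lex rX rO u' w'"
    and "db_less_tie rX rO a b \<Longrightarrow> db_less_tie rX rO b c \<Longrightarrow> db_less_tie rX rO a c"
  using assms
proof (induction rX rO u v and rX rO u' v' and rX rO a b arbitrary: w and w' and c
    rule: db_less_db_less_lex_db_less_tie.induct)
  case (1 rX rO u v)
  then show ?case
    using db_less.simps[of rX rO u v] db_less.simps[of rX rO v w] db_less.simps[of rX rO u w]
    by auto
next
  case (2 rX rO a u b v)
  then show ?case by (cases w') auto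
next
  case (5 rX rO x y)
  then show ?case by (cases c) (auto dest: transD)
next
  case (8 rX rO \<alpha> u \<beta> v)
  then show ?case by (cases c) (auto dest: transD)
next
  case (6 rX rO x \<beta> v)
  then show ?case by (cases c) auto
qed simp_all

section \<open>Compatibility with contexts\<close>

lemma db_less_lex_append_left:
  "db_less_lex rX rO u v \<Longrightarrow> db_less_lex rX rO (w @ u) (w @ v)"
  by (induction w) auto

text \<open>\<open>db_less_lex\<close> is false once either list runs out, so a true comparison is
  decided inside both lists, before \<open>w\<close> is reached. Hence equal length is not
  assumed.\<close>

lemma db_less_lex_append_right:
  "db_less_lex rX rO u v \<Longrightarrow> db_less_lex rX rO (u @ w) (v @ w)"
  by (induction u v rule: list_induct2') auto

text \<open>Degree and breadth are additive, so the contribution of \<open>w\<close> cancels in both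
  comparisons.\<close>

lemma db_less_append_left: "db_less rX rO u v \<Longrightarrow> db_less rX rO (w @ u) (w @ v)"
  by (auto simp: db_less.simps db_less_lex_append_left)

lemma db_less_append_right: "db_less rX rO u v \<Longrightarrow> db_less rX rO (u @ w) (v @ w)"
  by (auto simp: db_less.simps db_less_lex_append_right)

text \<open>The bracket adds one to both degrees and makes both breadths one. If the degrees tie,
  the operators agree and the tie-break returns to the contents.\<close>

lemma db_less_Bracket: "db_less rX rO u v \<Longrightarrow> db_less rX rO [Bracket \<omega> u] [Bracket \<omega> v]"
  by (subst db_less.simps) (auto simp: deg_def db_less.simps[of rX rO u v])

lemma plug_prime_cong_no_star: "occs_prime None p = 0 \<Longrightarrow> plug_prime u p = plug_prime v p"
proof (induction p)
  case (Bracket \<omega> w)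
  then have "map (plug_prime u) w = map (plug_prime v) w" by auto
  then show ?case by (simp only: plug_prime.simps)
qed (auto split: option.splits if_splits)

text \<open>The star sits in a single prime factor and the other factors do not change, so only
  multiplication on the left and right remains. Monotonicity for single primes is a premise so that
  the lemma serves both the contents of a bracket and the outermost word.\<close>

lemma db_less_concat_plug_prime:
  assumes "\<And>p. p \<in> set q \<Longrightarrow> occs_prime None p = 1 \<Longrightarrow>
      db_less rX rO (plug_prime u p) (plug_prime v p)"
    and "sum_list (map (occs_prime None) q) = 1"
  shows "db_less rX rO (concat (map (plug_prime u) q)) (concat (map (plug_prime v) q))"
  using assms
proof (induction q)
  case (Cons p q)
  show ?case
  proof (cases "occs_prime None p")
    case 0
    then show ?thesis
      using Cons plug_prime_cong_no_star[OF 0, of u v] by (simp add: db_less_append_left)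
  next
    case (Suc n)
    \<comment> \<open>The total count is one, so a star in the first factor exhausts it.\<close>
    then have p: "occs_prime None p = 1" and q: "\<And>p'. p' \<in> set q \<Longrightarrow> occs_prime None p' = 0"
      using Cons.prems(2) by auto
    have "map (plug_prime u) q = map (plug_prime v) q"
      using q by (auto intro: plug_prime_cong_no_star)
    then have "concat (map (plug_prime u) q) = concat (map (plug_prime v) q)"
      by (rule arg_cong)
    then show ?thesis using Cons.prems(1) p by (simp add: db_less_append_right)
  qed
qed simp

lemma db_less_plug_prime:
  assumes "db_less rX rO u v"
  shows "occs_prime None p = 1 \<Longrightarrow> db_less rX rO (plug_prime u p) (plug_prime v p)"
proof (induction p)
  case (Bracket \<omega> w)
  then show ?case by (auto intro!: db_less_Bracket db_less_concat_plug_prime)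
qed (use assms in \<open>auto split: option.splits if_splits\<close>)

lemma db_less_plug:
  "db_less rX rO u v \<Longrightarrow> occs None q = 1 \<Longrightarrow> db_less rX rO (plug q u) (plug q v)"
  unfolding plug_def occs_def by (intro db_less_concat_plug_prime db_less_plug_prime)

section \<open>Well-foundedness\<close>

text \<open>Along a descending chain \<open>f\<close> never increases, so it is eventually constant
  and the chain ends up in one level. The levels used below are the kind of prime, the degree of a
  prime, the breadth and the degree of a word.\<close>

lemma wf_stratified:
  fixes f :: "'a \<Rightarrow> nat"
  assumes le: "\<And>x y. (x, y) \<in> r \<Longrightarrow> f x \<le> f y"
    and wf: "\<And>n. wf {(x, y) \<in> r. f x = n \<and> f y = n}"
  shows "wf r"
proof -
  have "x \<in> Wellfounded.acc r" if "f x = n" for x n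
    using that
  proof (induction n arbitrary: x rule: less_induct)
    case (less n)
    \<comment> \<open>Predecessors in lower levels fall under the outer induction, those in level
      \<open>n\<close> under the inner one.\<close>
    have "f x = n \<longrightarrow> x \<in> Wellfounded.acc r"
    proof (induction x rule: wf_induct_rule[OF wf[of n]])
      case (1 x)
      show ?case
      proof
        assume x: "f x = n"
        show "x \<in> Wellfounded.acc r"
        proof (rule accI)
          fix y assume "(y, x) \<in> r"
          then show "y \<in> Wellfounded.acc r"
            using le[of y x] less.IH[of "f y" y] 1[of y] x by (cases "f y = n") auto
        qed
      qed
    qed
    then show ?case using less.prems by simp
  qed
  then show ?thesis by (auto intro: acc_wfI)
qed

definition db_prime_rel :: "'x rel \<Rightarrow> 'l rel \<Rightarrow> nat \<Rightarrow> ('l, 'x) prime_elem rel" where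
  "db_prime_rel rX rO k = {(a, b). deg_prime a = k \<and> deg_prime b = k \<and> db_less_tie rX rO a b}"

definition db_word_rel :: "'x rel \<Rightarrow> 'l rel \<Rightarrow> nat \<Rightarrow> ('l, 'x) bword rel" where
  "db_word_rel rX rO n = {(u, v). deg u = n \<and> deg v = n \<and> db_less rX rO u v}"

lemma db_word_relD:
  assumes "(u, v) \<in> db_word_rel rX rO n"
  shows "deg u = n" "deg v = n" "length u < length v \<or> length u = length v \<and> db_less_lex rX rO u v"
proof -
  show "deg u = n" and "deg v = n" using assms by (simp_all add: db_word_rel_def)
  then show "length u < length v \<or> length u = length v \<and> db_less_lex rX rO u v"
    using assms db_less.simps[of rX rO u v] by (simp add: db_word_rel_def)
qed

text \<open>Letters lie below brackets, so the two kinds are separate levels: letters embed into the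
  strict order on letters, brackets into a lexicographic product of operators and contents. The
  premise on \<open>m < k\<close> is what the strong induction on the degree will supply.\<close>

lemma wf_db_prime_rel:
  fixes rX :: "'x rel" and rO :: "'l rel"
  assumes X: "wf (rX - Id)" and O: "wf (rO - Id)"
    and W: "\<And>m. m < k \<Longrightarrow> wf (db_word_rel rX rO m)"
  shows "wf (db_prime_rel rX rO k)"
proof -
  define is_br :: "('l, 'x) prime_elem \<Rightarrow> nat" where
    "is_br = (\<lambda>a. case a of Letter _ \<Rightarrow> 0 | Bracket _ _ \<Rightarrow> 1)"
  have le: "is_br a \<le> is_br b" if "(a, b) \<in> db_prime_rel rX rO k" for a b
    using that by (cases a; cases b) (auto simp: is_br_def db_prime_rel_def)
  have "wf {(a, b) \<in> db_prime_rel rX rO k. is_br a = n \<and> is_br b = n}" for n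
  proof (cases "n = 0")
    case True
    \<comment> \<open>The value at brackets is arbitrary, since this level contains letters
      only.\<close>
    define g :: "('l, 'x) prime_elem \<Rightarrow> 'x" where
      "g = (\<lambda>a. case a of Letter x \<Rightarrow> x | Bracket _ _ \<Rightarrow> undefined)"
    have "{(a, b) \<in> db_prime_rel rX rO k. is_br a = n \<and> is_br b = n} \<subseteq> inv_image (rX - Id) g"
      using True by (auto simp: is_br_def g_def db_prime_rel_def split: prime_elem.splits)
    then show ?thesis using wf_inv_image[OF X] wf_subset by blast
  next
    case False
    define g :: "('l, 'x) prime_elem \<Rightarrow> 'l \<times> ('l, 'x) bword" where
      "g = (\<lambda>a. case a of Letter x \<Rightarrow> undefined | Bracket \<omega> w \<Rightarrow> (\<omega>, w))"
    have "wf (db_word_rel rX rO (k - 1))" if "k > 0" using W that by simp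
    moreover have "{(a, b) \<in> db_prime_rel rX rO k. is_br a = n \<and> is_br b = n}
        \<subseteq> inv_image ((rO - Id) <*lex*> db_word_rel rX rO (k - 1)) g"
      using False
      by (auto simp: is_br_def g_def db_prime_rel_def db_word_rel_def deg_def
          split: prime_elem.splits)
    \<comment> \<open>Split off because \<open>k - 1\<close> truncates at 0; every prime has
      positive degree.\<close>
    moreover have "db_prime_rel rX rO k = {}" if "k = 0"
    proof -
      have "deg_prime (a :: ('l, 'x) prime_elem) \<noteq> 0" for a by (cases a) auto
      then show ?thesis using that by (auto simp: db_prime_rel_def)
    qed
    ultimately show ?thesis
      using O by (cases "k = 0") (simp, meson wf_inv_image wf_lex_prod wf_subset gr0I)
  qed
  then show ?thesis using le by (rule wf_stratified[rotated])
qed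

text \<open>The bound \<open>n\<close> is built into the relation on primes because, inside the
  induction on the degree, well-foundedness is available only for primes up to that degree.\<close>

lemma db_less_lex_imp_lex:
  assumes "db_less_lex rX rO u v" "length u = length v" "\<And>a. a \<in> set u \<union> set v \<Longrightarrow> deg_prime a \<le> n"
  shows "(u, v) \<in> lex {(a, b). deg_prime a \<le> n \<and> deg_prime b \<le> n \<and>
    (deg_prime a < deg_prime b \<or> deg_prime a = deg_prime b \<and> db_less_tie rX rO a b)}"
  using assms by (induction u v rule: list_induct2') auto

lemma wf_db_word_rel:
  fixes rX :: "'x rel" and rO :: "'l rel"
  assumes X: "wf (rX - Id)" and O: "wf (rO - Id)"
  shows "wf (db_word_rel rX rO n)"
proof (induction n rule: less_induct)
  case (less n)
  define P :: "('l, 'x) prime_elem rel" where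
    "P = {(a, b). deg_prime a \<le> n \<and> deg_prime b \<le> n \<and>
      (deg_prime a < deg_prime b \<or> deg_prime a = deg_prime b \<and> db_less_tie rX rO a b)}"
  have "wf P"
  proof (rule wf_stratified)
    show "deg_prime a \<le> deg_prime b" if "(a, b) \<in> P" for a b
      using that by (auto simp: P_def)
    show "wf {(a, b) \<in> P. deg_prime a = k \<and> deg_prime b = k}" for k
    proof (cases "k \<le> n")
      case True
      then have "wf (db_prime_rel rX rO k)"
        using less by (intro wf_db_prime_rel X O) auto
      then show ?thesis by (rule wf_subset) (auto simp: P_def db_prime_rel_def)
    next
      case False
      then have empty: "{(a, b) \<in> P. deg_prime a = k \<and> deg_prime b = k} = {}" by (auto simp: P_def)
      show ?thesis unfolding empty by simp
    qed
  qed
  show ?case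
  proof (rule wf_stratified[where f = length])
    show "length u \<le> length v" if "(u, v) \<in> db_word_rel rX rO n" for u v
      using db_word_relD(3)[OF that] by linarith
    show "wf {(u, v) \<in> db_word_rel rX rO n. length u = m \<and> length v = m}" for m
    \<comment> \<open>Fixing the breadth is essential: \<open>lex\<close> relates only lists of
      equal length, and a dictionary order on lists of unbounded length need not be
      well-founded.\<close>
    proof (rule wf_subset[OF wf_lex[OF \<open>wf P\<close>]], rule subrelI)
      fix u v assume "(u, v) \<in> {(u, v) \<in> db_word_rel rX rO n. length u = m \<and> length v = m}"
      then have "(u, v) \<in> db_word_rel rX rO n" and len: "length u = length v" by simp_all
      note uv = db_word_relD[OF this(1)]
      \<comment> \<open>A summand of the degree is at most the degree, so all factors lie in the
        range of \<open>P\<close>.\<close>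
      have "deg_prime a \<le> n" if "a \<in> set u \<union> set v" for a
        using that uv(1,2) member_le_sum_list[of "deg_prime a" "map deg_prime u"]
          member_le_sum_list[of "deg_prime a" "map deg_prime v"]
        by (auto simp: deg_def)
      then show "(u, v) \<in> lex P"
        using uv(3) len unfolding P_def by (intro db_less_lex_imp_lex) simp_all
    qed
  qed
qed

lemma wf_db_less:
  assumes "wf (rX - Id)" "wf (rO - Id)"
  shows "wf {(u, v). db_less rX rO u v}"
proof (rule wf_stratified)
  show "deg u \<le> deg v" if "(u, v) \<in> {(u, v). db_less rX rO u v}" for u v
    using that by (auto simp: db_less.simps)
  show "wf {(u, v) \<in> {(u, v). db_less rX rO u v}. deg u = n \<and> deg v = n}" for n
    using wf_db_word_rel[OF assms, of n] by (rule wf_subset) (auto simp: db_word_rel_def)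
qed

section \<open>The monomial order\<close>

lemma monomial_order_db_order:
  assumes rX: "well_order_on X rX" and rO: "well_order_on \<Lambda> rO"
  shows "monomial_order \<Lambda> X (db_order \<Lambda> X rX rO)"
proof -
  have wf: "wf {(u, v). db_less rX rO u v}"
    using rX rO by (intro wf_db_less) (auto simp: well_order_on_def)
  \<comment> \<open>Irreflexivity comes from well-foundedness, without a further recursion.\<close>
  have irrefl: "\<not> db_less rX rO u u" for u
    using wf_not_refl[OF wf] by auto
  \<comment> \<open>\<open>db_less_trans\<close> asks for transitive strict parts; antisymmetry of
    the base orders provides this.\<close>
  have trans: "db_less rX rO u w" if "db_less rX rO u v" "db_less rX rO v w" for u v w
    using that rX rO
    by (intro db_less_trans(1)[of rX rO u v w] trans_diff_Id)
      (auto simp: well_order_on_def linear_order_on_def partial_order_on_def preorder_on_def)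
  have total: "u = v \<or> db_less rX rO u v \<or> db_less rX rO v u"
    if "u \<in> bwords \<Lambda> X" "v \<in> bwords \<Lambda> X" for u v
    using that rX rO by (intro db_less_total(1)) (auto simp: well_order_on_def linear_order_on_def)
  have "well_order_on (bwords \<Lambda> X) (db_order \<Lambda> X rX rO)"
    unfolding well_order_on_def linear_order_on_def partial_order_on_def preorder_on_def
  proof (intro conjI)
    show "wf (db_order \<Lambda> X rX rO - Id)"
      using wf by (rule wf_subset) (auto simp: db_order_def)
    show "antisym (db_order \<Lambda> X rX rO)"
      using trans irrefl by (auto simp: db_order_def antisym_def)
    show "trans (db_order \<Lambda> X rX rO)"
      using trans by (auto simp: db_order_def trans_def)
  qed (use total in \<open>auto simp: db_order_def refl_on_def total_on_def\<close>)
  moreover have "(plug q u, plug q v) \<in> db_order \<Lambda> X rX rO - Id"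
    if "u \<in> bwords \<Lambda> X" "v \<in> bwords \<Lambda> X" "q \<in> star_bwords \<Lambda> X"
      "(u, v) \<in> db_order \<Lambda> X rX rO - Id" for u v q
  proof -
    have less: "db_less rX rO (plug q u) (plug q v)"
      using that by (intro db_less_plug) (auto simp: db_order_def star_bwords_def)
    then have "plug q u \<noteq> plug q v" using irrefl by metis
    then show ?thesis
      using that less by (auto simp: db_order_def star_bwords_def intro: plug_in_bwords)
  qed
  ultimately show ?thesis by (auto simp: monomial_order_def)
qed

theorem proposition2p16:
  fixes \<Omega> :: "'w set" and X :: "'x set"
    and rX :: "'x rel" and rO :: "('w + 'w) rel"
  assumes "\<Omega> \<noteq> {}"
    and "well_order_on X rX"
    and "well_order_on (\<Omega> <+> \<Omega>) rO"
  shows "monomial_order (\<Omega> <+> \<Omega>) X (db_order (\<Omega> <+> \<Omega>) X rX rO)"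
  using assms(2,3) by (rule monomial_order_db_order)

end
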